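(* Let $G_\bullet$ be a vertex-stable $\mathrm{FI}$-graph of stable degree $\leq d$, and let $H$ be a graph. Then there exists a polynomial $p_H(x) \in \mathbb{Q}[x]$ of degree $\leq |V(H)|\cdot d$ such that for all $n \gg 0$ the number of subgraphs of $G_n$ isomorphic to $H$ equals $p_H(n)$.
   Context: Graphs are finite and simple (no multi-edges, no self-loops), possibly disconnected. A homomorphism of graphs $\phi:G\to G'$ is a map $V(G)\to V(G')$ such that $\{x,y\}\in E(G)$ implies $\{\phi(x),\phi(y)\}\in E(G')$. A subgraph of $G$ is a graph $G'$ with $V(G')\subseteq V(G)$ and $E(G')\subseteq E(G)$. Let $[n]=\{1,\dots,n\}$, and let $\mathrm{FI}$ be the category with objects $[n]$, $n\ge 0$, and morphisms all injections. An $\mathrm{FI}$-graph $G_\bullet$ is a functor from $\mathrm{FI}$ to the category of graphs and graph homomorphisms; $G_n$ is its value on $[n]$ and $G(f)$ is the map induced by an injection $f$. $G_\bullet$ is vertex-stable with stable degree $\le d$ if for all $n\ge d$ and every $v\in V(G_{n+1})$ there exist $w\in V(G_n)$ and an injection $f:[n]\hookrightarrow[n+1]$ with $G(f)(w)=v$. "For all $n\gg 0$" means for all sufficiently large $n$. The zero polynomial is regarded as having degree at most any bound. *)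

theory Defs
  imports "HOL-Library.FuncSet" "HOL-Computational_Algebra.Polynomial"
begin

record 'a ugraph =
  verts :: "'a set"
  edges :: "'a set set"

definition simple_graph :: "'a ugraph \<Rightarrow> bool" where
  "simple_graph G \<longleftrightarrow>
     finite (verts G) \<and> (\<forall>e \<in> edges G. e \<subseteq> verts G \<and> card e = 2)"

text \<open>Edges are two-element sets, so a homomorphism cannot identify adjacent vertices.\<close>

definition graph_hom :: "('a \<Rightarrow> 'b) \<Rightarrow> 'a ugraph \<Rightarrow> 'b ugraph \<Rightarrow> bool" where
  "graph_hom \<phi> G G' \<longleftrightarrow>
     \<phi> \<in> verts G \<rightarrow> verts G' \<and>
     (\<forall>x y. {x, y} \<in> edges G \<longrightarrow> {\<phi> x, \<phi> y} \<in> edges G')"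

definition graph_iso :: "'a ugraph \<Rightarrow> 'b ugraph \<Rightarrow> bool" where
  "graph_iso G H \<longleftrightarrow>
     (\<exists>\<phi>. bij_betw \<phi> (verts G) (verts H) \<and>
          (\<forall>x \<in> verts G. \<forall>y \<in> verts G. {x, y} \<in> edges G \<longleftrightarrow> {\<phi> x, \<phi> y} \<in> edges H))"

text \<open>Subgraphs need not be induced, and may have isolated vertices.\<close>

definition subgraphs :: "'a ugraph \<Rightarrow> 'a ugraph set" where
  "subgraphs G = {K. simple_graph K \<and> verts K \<subseteq> verts G \<and> edges K \<subseteq> edges G}"

text \<open>
  Morphisms \<open>[m] \<rightarrow> [n]\<close> of the category FI, where \<open>[n] = {1..n}\<close>.  Extensionality
  makes equality of morphisms (with given source and target) equality of functions.
\<close>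

definition FI_hom :: "nat \<Rightarrow> nat \<Rightarrow> (nat \<Rightarrow> nat) set" where
  "FI_hom m n = {f \<in> {1..m} \<rightarrow>\<^sub>E {1..n}. inj_on f {1..m}}"

text \<open>
  A functor from FI to graphs: \<open>G n\<close> is the value on \<open>[n]\<close>, and \<open>T m n f\<close> is the map
  induced by \<open>f : [m] \<rightarrow> [n]\<close>; the target \<open>n\<close> cannot be recovered from \<open>f\<close>.  Only the values
  of \<open>T m n f\<close> on \<open>verts (G m)\<close> are relevant.
\<close>

locale FI_graph =
  fixes G :: "nat \<Rightarrow> 'a ugraph"
    and T :: "nat \<Rightarrow> nat \<Rightarrow> (nat \<Rightarrow> nat) \<Rightarrow> 'a \<Rightarrow> 'a"
  assumes graph: "simple_graph (G n)"
    and hom: "f \<in> FI_hom m n \<Longrightarrow> graph_hom (T m n f) (G m) (G n)"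
    and map_id: "v \<in> verts (G n) \<Longrightarrow> T n n (\<lambda>i\<in>{1..n}. i) v = v"
    and map_comp: "f \<in> FI_hom l m \<Longrightarrow> g \<in> FI_hom m n \<Longrightarrow> v \<in> verts (G l) \<Longrightarrow>
                     T l n (compose {1..l} g f) v = T m n g (T l m f v)"

definition vertex_stable ::
    "(nat \<Rightarrow> 'a ugraph) \<Rightarrow> (nat \<Rightarrow> nat \<Rightarrow> (nat \<Rightarrow> nat) \<Rightarrow> 'a \<Rightarrow> 'a) \<Rightarrow> nat \<Rightarrow> bool" where
  "vertex_stable G T d \<longleftrightarrow>
     (\<forall>n \<ge> d. \<forall>v \<in> verts (G (n + 1)).
        \<exists>w \<in> verts (G n). \<exists>f \<in> FI_hom n (n + 1). T n (n + 1) f w = v)"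

end

theory Submission
  imports Defs
begin

text \<open>
  With \<open>D = |V(H)| d\<close>, every copy of \<open>H\<close> in \<open>G\<^sub>n\<close> is the image of an embedding \<open>G(f) \<circ> x\<close> for an injection
  \<open>f : [D] \<rightarrow> [n]\<close> and a labelling \<open>x : V(H) \<rightarrow> V(G\<^sub>D)\<close>.  For large \<open>n\<close>, whether \<open>(f, x)\<close> gives an embedding
  depends only on \<open>x\<close>, and whether \<open>(f, x)\<close> and \<open>(g, y)\<close> give the same copy depends only on \<open>x\<close>, \<open>y\<close> and on
  how \<open>f\<close> and \<open>g\<close> overlap.  Hence the number of pairs giving the same copy as \<open>(f, x)\<close> is a polynomial
  \<open>q\<^sub>x(n)\<close>, and the number of copies is \<open>\<Sum>\<^sub>x n(n-1)\<dots>(n-D+1) / q\<^sub>x(n)\<close>, a rational function of \<open>n\<close>.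
  A rational function with integer values at all large \<open>n\<close> is a polynomial, and this one is \<open>O(n\<^sup>D)\<close>.
\<close>

subsection \<open>Eventually polynomial and eventually rational sequences\<close>

lemma abs_poly_le:
  fixes p :: "'a::linordered_idom poly"
  assumes "degree p \<le> k" "1 \<le> x"
  shows "\<bar>poly p x\<bar> \<le> (\<Sum>i\<le>degree p. \<bar>coeff p i\<bar>) * x ^ k"
proof -
  have "\<bar>poly p x\<bar> \<le> (\<Sum>i\<le>degree p. \<bar>coeff p i * x ^ i\<bar>)"
    unfolding poly_altdef by (rule sum_abs)
  also have "\<dots> \<le> (\<Sum>i\<le>degree p. \<bar>coeff p i\<bar> * x ^ k)"
    using assms by (intro sum_mono) (auto simp: abs_mult intro!: mult_left_mono power_increasing)
  finally show ?thesis by (simp add: sum_distrib_right)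
qed

text \<open>The leading term \<open>a * x ^ Suc k\<close> of \<open>q\<close> outgrows the rest:
  \<open>p\<close> and the remaining part \<open>r\<close> of \<open>q\<close> are both bounded by a
  constant times \<open>x ^ k\<close>. The free factor \<open>c\<close> later absorbs a denominator
  or the constant of a growth bound.\<close>

lemma eventually_poly_less_poly:
  fixes p q :: "'a::archimedean_field poly"
  assumes "degree p < degree q"
  shows "\<forall>\<^sub>F n in sequentially. c * \<bar>poly p (of_nat n)\<bar> < \<bar>poly q (of_nat n)\<bar>"
proof -
  define k where "k = degree q - 1"
  define a where "a = lead_coeff q"
  define r where "r = q - monom a (Suc k)"
  have k: "degree q = Suc k" and pk: "degree p \<le> k"
    using assms by (auto simp: k_def)
  have "q \<noteq> 0" using k by auto
  then have a: "a \<noteq> 0" by (simp add: a_def)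
  have r: "degree r \<le> k"
  proof (rule degree_le, intro allI impI)
    fix i assume "i > k"
    then show "coeff r i = 0"
      using k by (cases "i = Suc k") (auto simp: r_def a_def coeff_eq_0)
  qed
  define M where "M = (\<Sum>i\<le>degree p. \<bar>coeff p i\<bar>)"
  define M' where "M' = (\<Sum>i\<le>degree r. \<bar>coeff r i\<bar>)"
  obtain N :: nat where N: "(\<bar>c\<bar> * M + M') / \<bar>a\<bar> < of_nat N"
    using reals_Archimedean2 by blast
  show ?thesis
  proof (rule eventually_sequentiallyI[of "Suc N"])
    fix n assume n: "Suc N \<le> n"
    define x :: 'a where "x = of_nat n"
    have x: "1 \<le> x" using n by (simp add: x_def)
    have "of_nat N \<le> x" using n by (simp add: x_def)
    with N have "(\<bar>c\<bar> * M + M') / \<bar>a\<bar> < x" by linarith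
    then have less: "\<bar>c\<bar> * M + M' < \<bar>a\<bar> * x"
      using a by (simp add: divide_simps mult.commute)
    have "c * \<bar>poly p x\<bar> \<le> \<bar>c\<bar> * \<bar>poly p x\<bar>"
      by (intro mult_right_mono) auto
    also have "\<dots> \<le> \<bar>c\<bar> * (M * x ^ k)"
      using abs_poly_le[OF pk x] by (intro mult_left_mono) (auto simp: M_def)
    finally have 1: "c * \<bar>poly p x\<bar> \<le> \<bar>c\<bar> * M * x ^ k" by (simp add: mult.assoc)
    have 2: "\<bar>poly r x\<bar> \<le> M' * x ^ k"
      using abs_poly_le[OF r x] by (simp add: M'_def)
    have q: "poly q x = a * x ^ Suc k + poly r x"
      by (simp add: r_def poly_monom)
    have 3: "(\<bar>c\<bar> * M + M') * x ^ k < \<bar>a * x ^ Suc k\<bar>"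
      using less x mult_strict_right_mono[OF less, of "x ^ k"]
      by (simp add: abs_mult ac_simps)
    show "c * \<bar>poly p (of_nat n)\<bar> < \<bar>poly q (of_nat n)\<bar>"
      using 1 2 3 unfolding x_def[symmetric] q by (simp add: algebra_simps abs_if split: if_splits)
  qed
qed

lemma eventually_poly_nonzero:
  fixes p :: "'a::archimedean_field poly"
  assumes "p \<noteq> 0"
  shows "\<forall>\<^sub>F n in sequentially. poly p (of_nat n) \<noteq> 0"
proof (cases "degree p = 0")
  case True
  then obtain a where "p = [:a:]" by (rule degree_eq_zeroE)
  with assms show ?thesis by simp
next
  case False
  then have "degree (0 :: 'a poly) < degree p" by simp
  from eventually_poly_less_poly[OF this, of 1] show ?thesis by eventually_elim auto
qed

text \<open>Otherwise \<open>p\<close> would eventually exceed \<open>c\<close> times the monomial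
  of degree \<open>k\<close>.\<close>

lemma degree_le_if_poly_bounded:
  fixes p :: "'a::archimedean_field poly"
  assumes "\<forall>\<^sub>F n in sequentially. \<bar>poly p (of_nat n)\<bar> \<le> c * of_nat n ^ k"
  shows "degree p \<le> k"
proof (rule ccontr)
  assume "\<not> degree p \<le> k"
  then have "degree (monom (1::'a) k) < degree p" by (simp add: degree_monom_eq)
  from eventually_poly_less_poly[OF this, of c] assms
  have "\<forall>\<^sub>F n :: nat in sequentially. False"
    by eventually_elim (simp add: poly_monom)
  then show False by simp
qed

text \<open>Horner's scheme: a denominator for \<open>p\<close> times the denominator of
  \<open>a\<close> serves for \<open>pCons a p\<close>.\<close>

lemma rat_poly_common_denominator:
  "\<exists>m::nat. m \<noteq> 0 \<and> (\<forall>n::nat. of_nat m * poly p (of_nat n) \<in> (\<int> :: rat set))"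
proof (induction p)
  case 0
  then show ?case by (intro exI[of _ 1]) auto
next
  case (pCons a p)
  then obtain m :: nat where m: "m \<noteq> 0" "\<And>n::nat. of_nat m * poly p (of_nat n) \<in> (\<int> :: rat set)"
    by blast
  obtain u v where v: "v > 0" "a = of_int u / of_int v"
    by (metis quotient_of_denom_pos quotient_of_div surj_pair)
  have "of_nat (m * nat v) * poly (pCons a p) (of_nat n) \<in> (\<int> :: rat set)" for n
  proof -
    have "of_nat (m * nat v) * poly (pCons a p) (of_nat n) =
        of_nat m * of_int u + of_int v * of_nat n * (of_nat m * poly p (of_nat n))"
      using v by (simp add: field_simps)
    then show ?thesis using m(2) by auto
  qed
  with m v show ?case by (intro exI[of _ "m * nat v"]) auto
qed

section \<open>Sequences that eventually agree with polynomials or rational functions\<close>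

definition eventually_polynomial :: "(nat \<Rightarrow> rat) \<Rightarrow> bool" where
  "eventually_polynomial a \<longleftrightarrow> (\<exists>p. \<forall>\<^sub>F n in sequentially. a n = poly p (of_nat n))"

text \<open>The equation is free of division, so nothing depends on the value of a quotient at a
  root of \<open>q\<close>.\<close>

definition eventually_rational :: "(nat \<Rightarrow> rat) \<Rightarrow> bool" where
  "eventually_rational a \<longleftrightarrow>
     (\<exists>p q. q \<noteq> 0 \<and> (\<forall>\<^sub>F n in sequentially. a n * poly q (of_nat n) = poly p (of_nat n)))"

text \<open>Dividing with remainder and clearing denominators, the remainder contributes an integer
  that tends to \<open>0\<close>.\<close>

lemma eventually_polynomial_if_rational:
  fixes a :: "nat \<Rightarrow> nat"
  assumes "eventually_rational (\<lambda>n. of_nat (a n))"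
  shows "eventually_polynomial (\<lambda>n. of_nat (a n))"
proof -
  from assms obtain p q where q: "q \<noteq> 0"
    and ev: "\<forall>\<^sub>F n in sequentially. rat_of_nat (a n) * poly q (of_nat n) = poly p (of_nat n)"
    by (auto simp: eventually_rational_def)
  define s where "s = p div q"
  define r where "r = p mod q"
  have p: "p = s * q + r" by (simp add: s_def r_def)
  have "r = 0"
  proof (rule ccontr)
    assume "r \<noteq> 0"
    then have "degree r < degree q"
      using degree_mod_less[OF q, of p] by (auto simp: r_def)
    obtain m :: nat where m: "m \<noteq> 0" "\<And>n::nat. of_nat m * poly s (of_nat n) \<in> (\<int> :: rat set)"
      using rat_poly_common_denominator by blast
    have "\<forall>\<^sub>F n :: nat in sequentially. False"
      using ev eventually_poly_less_poly[OF \<open>degree r < degree q\<close>, of "of_nat m"]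
        eventually_poly_nonzero[OF q] eventually_poly_nonzero[OF \<open>r \<noteq> 0\<close>]
    proof eventually_elim
      case (elim n)
      \<comment> \<open>\<open>z\<close> is \<open>m\<close> times r(n)/q(n): an integer because
        \<open>m\<close> clears the denominators of \<open>s\<close>, nonzero because r(n) is, yet
        of absolute value below 1 by the growth comparison.\<close>
      define z where "z = rat_of_nat m * of_nat (a n) - of_nat m * poly s (of_nat n)"
      have "z \<in> \<int>" unfolding z_def using m(2) by auto
      have eq: "z * poly q (of_nat n) = of_nat m * poly r (of_nat n)"
        using elim(1) unfolding z_def p by (simp add: algebra_simps)
      with elim m have "z \<noteq> 0" by auto
      with \<open>z \<in> \<int>\<close> have "1 \<le> \<bar>z\<bar>" by (rule Ints_nonzero_abs_ge1)
      then have "\<bar>poly q (of_nat n)\<bar> \<le> \<bar>z\<bar> * \<bar>poly q (of_nat n)\<bar>"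
        by (simp add: mult_le_cancel_right1)
      also have "\<dots> = of_nat m * \<bar>poly r (of_nat n)\<bar>"
        using eq by (metis abs_mult abs_of_nat)
      finally show False using elim by linarith
    qed
    then show False by simp
  qed
  have "\<forall>\<^sub>F n in sequentially. rat_of_nat (a n) = poly s (of_nat n)"
    using ev eventually_poly_nonzero[OF q]
    by eventually_elim (simp add: p \<open>r = 0\<close>)
  then show ?thesis by (auto simp: eventually_polynomial_def)
qed

lemma eventually_polynomial_const: "eventually_polynomial (\<lambda>n. c)"
  unfolding eventually_polynomial_def by (intro exI[of _ "[:c:]"]) simp

lemma eventually_polynomial_add:
  assumes "eventually_polynomial a" "eventually_polynomial b"
  shows "eventually_polynomial (\<lambda>n. a n + b n)"
proof -
  from assms obtain p q where "\<forall>\<^sub>F n in sequentially. a n = poly p (of_nat n)"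
    "\<forall>\<^sub>F n in sequentially. b n = poly q (of_nat n)"
    by (auto simp: eventually_polynomial_def)
  then have "\<forall>\<^sub>F n in sequentially. a n + b n = poly (p + q) (of_nat n)"
    by eventually_elim simp
  then show ?thesis unfolding eventually_polynomial_def by (rule exI)
qed

lemma eventually_polynomial_sum:
  assumes "finite A" "\<And>x. x \<in> A \<Longrightarrow> eventually_polynomial (a x)"
  shows "eventually_polynomial (\<lambda>n. \<Sum>x\<in>A. a x n)"
  using assms
  by (induction A) (auto intro: eventually_polynomial_const eventually_polynomial_add)

lemma eventually_polynomial_cong:
  assumes "eventually_polynomial a" "\<forall>\<^sub>F n in sequentially. a n = b n"
  shows "eventually_polynomial b"
proof -
  from assms obtain p where "\<forall>\<^sub>F n in sequentially. a n = poly p (of_nat n)"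
    by (auto simp: eventually_polynomial_def)
  with assms(2) have "\<forall>\<^sub>F n in sequentially. b n = poly p (of_nat n)"
    by eventually_elim simp
  then show ?thesis by (auto simp: eventually_polynomial_def)
qed

lemma eventually_rational_cong:
  assumes "eventually_rational a" "\<forall>\<^sub>F n in sequentially. a n = b n"
  shows "eventually_rational b"
proof -
  from assms obtain p q where "q \<noteq> 0" and
    "\<forall>\<^sub>F n in sequentially. a n * poly q (of_nat n) = poly p (of_nat n)"
    by (auto simp: eventually_rational_def)
  from assms(2) this(2) have "\<forall>\<^sub>F n in sequentially. b n * poly q (of_nat n) = poly p (of_nat n)"
    by eventually_elim simp
  with \<open>q \<noteq> 0\<close> show ?thesis by (auto simp: eventually_rational_def)
qed

lemma eventually_rational_add:
  assumes "eventually_rational a" "eventually_rational b"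
  shows "eventually_rational (\<lambda>n. a n + b n)"
proof -
  from assms obtain p q p' q' where q: "q \<noteq> 0" "q' \<noteq> 0"
    and ev: "\<forall>\<^sub>F n in sequentially. a n * poly q (of_nat n) = poly p (of_nat n)"
      "\<forall>\<^sub>F n in sequentially. b n * poly q' (of_nat n) = poly p' (of_nat n)"
    by (auto simp: eventually_rational_def)
  from ev have "\<forall>\<^sub>F n in sequentially.
      (a n + b n) * poly (q * q') (of_nat n) = poly (p * q' + p' * q) (of_nat n)"
    by eventually_elim (simp add: algebra_simps)
  with q show ?thesis unfolding eventually_rational_def by (metis mult_eq_0_iff)
qed

lemma eventually_rational_sum:
  assumes "finite A" "\<And>x. x \<in> A \<Longrightarrow> eventually_rational (a x)"
  shows "eventually_rational (\<lambda>n. \<Sum>x\<in>A. a x n)"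
  using assms
proof (induction A)
  case empty
  show ?case unfolding eventually_rational_def
    by (intro exI[of _ 0] exI[of _ 1]) simp
qed (auto intro: eventually_rational_add)

lemma eventually_rational_divide:
  assumes "eventually_polynomial a" "eventually_polynomial b"
    and "\<forall>\<^sub>F n in sequentially. b n \<noteq> 0"
  shows "eventually_rational (\<lambda>n. a n / b n)"
proof -
  from assms obtain p q where a: "\<forall>\<^sub>F n in sequentially. a n = poly p (of_nat n)"
    and b: "\<forall>\<^sub>F n in sequentially. b n = poly q (of_nat n)"
    by (auto simp: eventually_polynomial_def)
  \<comment> \<open>If \<open>q\<close> were zero, \<open>b\<close> would be eventually zero. As
    \<open>q \<noteq> 0\<close> does not mention \<open>n\<close>, it holds outright once it holds
    eventually.\<close>
  from b assms(3) have "\<forall>\<^sub>F n :: nat in sequentially. q \<noteq> 0" by eventually_elim auto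
  then have "q \<noteq> 0" by simp
  moreover have "\<forall>\<^sub>F n in sequentially. a n / b n * poly q (of_nat n) = poly p (of_nat n)"
    using a b assms(3) by eventually_elim simp
  ultimately show ?thesis by (auto simp: eventually_rational_def)
qed

text \<open>The count is a falling factorial with \<open>card A\<close> factors starting at n - D;
  from n = D + card A on, no subtraction of naturals is truncated. The lower bound \<open>D\<close>
  serves for injections that must avoid [D].\<close>

lemma eventually_polynomial_card_inj:
  assumes "finite A"
  shows "eventually_polynomial (\<lambda>n. of_nat (card {f \<in> A \<rightarrow>\<^sub>E {D<..n::nat}. inj_on f A}))"
proof -
  have "\<forall>\<^sub>F n in sequentially. of_nat (card {f \<in> A \<rightarrow>\<^sub>E {D<..n}. inj_on f A}) =
     poly (\<Prod>i<card A. [:- of_nat (D + i), 1:]) (rat_of_nat n)"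
  proof (rule eventually_sequentiallyI)
    fix n assume n: "D + card A \<le> n"
    have "card {f \<in> A \<rightarrow>\<^sub>E {D<..n}. inj_on f A} = (\<Prod>i<card A. n - D - i)"
      using assms by (subst card_inj_on_subset_funcset) (auto simp: atLeast0LessThan)
    also have "rat_of_nat \<dots> = (\<Prod>i<card A. of_nat n - of_nat (D + i))"
      using n by (auto simp: of_nat_diff intro!: prod.cong)
    finally show "of_nat (card {f \<in> A \<rightarrow>\<^sub>E {D<..n}. inj_on f A}) =
     poly (\<Prod>i<card A. [:- of_nat (D + i), 1:]) (rat_of_nat n)"
      by (simp add: poly_prod algebra_simps)
  qed
  then show ?thesis by (auto simp: eventually_polynomial_def)
qed

subsection \<open>Overlaps of injections\<close>

declare One_nat_def [simp del]

text \<open>Each element is weighted by one over the size of its fibre, so the weights in a fibre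
  add up to 1.\<close>

lemma card_image_eq_sum_inverse_fibres:
  assumes "finite Y"
  shows "of_nat (card (F ` Y)) = (\<Sum>z\<in>Y. 1 / of_nat (card {w \<in> Y. F w = F z}) :: 'a::field_char_0)"
proof -
  have "(\<Sum>z\<in>Y. 1 / of_nat (card {w \<in> Y. F w = F z}) :: 'a) =
    (\<Sum>u\<in>F ` Y. \<Sum>z\<in>{z \<in> Y. F z = u}. 1 / of_nat (card {w \<in> Y. F w = F z}))"
    by (rule sum.image_gen[OF assms])
  also have "\<dots> = (\<Sum>u\<in>F ` Y. 1)"
  proof (rule sum.cong[OF refl])
    fix u assume "u \<in> F ` Y"
    then have "card {z \<in> Y. F z = u} \<noteq> 0" using assms by auto
    moreover have "(\<Sum>z\<in>{z \<in> Y. F z = u}. 1 / of_nat (card {w \<in> Y. F w = F z}) :: 'a) =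
      (\<Sum>z\<in>{z \<in> Y. F z = u}. 1 / of_nat (card {w \<in> Y. F w = u}))"
      by (rule sum.cong) auto
    ultimately show "(\<Sum>z\<in>{z \<in> Y. F z = u}. 1 / of_nat (card {w \<in> Y. F w = F z}) :: 'a) = 1"
      by simp
  qed
  finally show ?thesis by simp
qed

text \<open>Either \<open>P\<close> holds somewhere past \<open>N\<close> and then persists, or it
  fails from \<open>N\<close> on. This makes properties that survive enlarging [n] independent of
  \<open>n\<close> for large \<open>n\<close>.\<close>

lemma eventually_constant_if_mono:
  assumes "\<And>n. N \<le> n \<Longrightarrow> P n \<Longrightarrow> P (Suc n)"
  shows "\<exists>b. \<forall>\<^sub>F n in sequentially. P n \<longleftrightarrow> b"
proof (cases "\<exists>n\<ge>N. P n")
  case True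
  then obtain m where m: "N \<le> m" "P m" by blast
  have "P n" if "m \<le> n" for n
    using that by (induction n rule: dec_induct) (use m assms in auto)
  then show ?thesis by (intro exI[of _ True] eventually_sequentiallyI[of m]) simp
next
  case False
  then show ?thesis by (intro exI[of _ False] eventually_sequentiallyI[of N]) auto
qed

section \<open>Morphisms of FI and the action of permutations\<close>

lemma finite_FI_hom: "finite (FI_hom m n)"
  by (rule finite_subset[of _ "{1..m} \<rightarrow>\<^sub>E {1..n}"]) (auto simp: FI_hom_def intro: finite_PiE)

text \<open>This crude count later bounds the degree of the counting polynomial.\<close>

lemma card_FI_hom_le: "card (FI_hom m n) \<le> n ^ m"
proof -
  have "card (FI_hom m n) \<le> card ({1..m} \<rightarrow>\<^sub>E {1..n})"
    by (rule card_mono) (auto simp: FI_hom_def intro: finite_PiE)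
  then show ?thesis by (simp add: card_funcsetE)
qed

lemma FI_hom_compose:
  assumes f: "f \<in> FI_hom l m" and g: "g \<in> FI_hom m n"
  shows "compose {1..l} g f \<in> FI_hom l n"
proof -
  have *: "f \<in> {1..l} \<rightarrow> {1..m}" "g \<in> {1..m} \<rightarrow> {1..n}" using f g by (simp_all add: FI_hom_def PiE_def)
  have "inj_on (compose {1..l} g f) {1..l}"
  proof (rule inj_onI)
    fix i j assume ij: "i \<in> {1..l}" "j \<in> {1..l}" "compose {1..l} g f i = compose {1..l} g f j"
    then have "g (f i) = g (f j)" by (simp add: compose_eq)
    moreover have "f i \<in> {1..m}" "f j \<in> {1..m}" using ij * by blast+
    ultimately have "f i = f j" using g by (auto simp: FI_hom_def dest: inj_onD)
    with ij f show "i = j" by (auto simp: FI_hom_def dest: inj_onD)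
  qed
  moreover have "compose {1..l} g f \<in> {1..l} \<rightarrow>\<^sub>E {1..n}"
    using funcset_compose[OF *] by (simp add: PiE_def)
  ultimately show ?thesis by (simp add: FI_hom_def)
qed

lemma inclusion_in_FI_hom: "m \<le> n \<Longrightarrow> (\<lambda>i\<in>{1..m}. i) \<in> FI_hom m n"
  by (auto simp: FI_hom_def inj_on_def)

text \<open>Agreement on [m] is enough, because both sides take the default value
  \<open>undefined\<close> elsewhere.\<close>

lemma compose_eq_FI_homI:
  assumes "g \<in> FI_hom m n" "\<And>i. i \<in> {1..m} \<Longrightarrow> \<sigma> (f i) = g i"
  shows "compose {1..m} \<sigma> f = g"
proof
  fix i
  have g: "g \<in> {1..m} \<rightarrow>\<^sub>E {1..n}" using assms(1) by (simp add: FI_hom_def)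
  show "compose {1..m} \<sigma> f i = g i"
  proof (cases "i \<in> {1..m}")
    case True
    with assms(2) show ?thesis by (simp add: compose_eq)
  next
    case False
    from PiE_arb[OF g this] False show ?thesis by (simp only: compose_def restrict_apply if_False)
  qed
qed

text \<open>The complements in [n] of \<open>A\<close> and of its image under \<open>h\<close> have
  the same size, so a bijection \<open>k\<close> between them completes \<open>h\<close> to a
  permutation of [n].\<close>

lemma FI_hom_extend:
  assumes A: "A \<subseteq> {1..n}" and h: "inj_on h A" "h ` A \<subseteq> {1..n}"
  obtains \<sigma> where "\<sigma> \<in> FI_hom n n" "\<And>i. i \<in> A \<Longrightarrow> \<sigma> i = h i"
proof -
  have fin: "finite A" using A finite_subset by blast
  have "card ({1..n} - A) = card ({1..n} - h ` A)"
    using A h fin by (simp add: card_Diff_subset card_image)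
  then obtain k where k: "bij_betw k ({1..n} - A) ({1..n} - h ` A)"
    using finite_same_card_bij by blast
  define \<sigma> where "\<sigma> = (\<lambda>i\<in>{1..n}. if i \<in> A then h i else k i)"
  have k_in: "k i \<in> {1..n} - h ` A" if "i \<in> {1..n} - A" for i
    by (rule bij_betw_apply[OF k that])
  have "inj_on \<sigma> {1..n}"
  proof (rule inj_onI)
    fix i j assume "i \<in> {1..n}" "j \<in> {1..n}" "\<sigma> i = \<sigma> j"
    then show "i = j"
      using inj_onD[OF h(1), of i j] inj_onD[OF bij_betw_imp_inj_on[OF k], of i j] k_in[of i] k_in[of j]
      by (cases "i \<in> A"; cases "j \<in> A") (simp_all add: \<sigma>_def, metis imageI)
  qed
  moreover have "\<sigma> \<in> {1..n} \<rightarrow>\<^sub>E {1..n}"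
    using h(2) k_in by (simp add: \<sigma>_def image_subset_iff)
  ultimately show ?thesis using A by (intro that[of \<sigma>]) (auto simp: FI_hom_def \<sigma>_def)
qed

text \<open>The permutation extends the map f(i) -> g(i), well defined on the image of
  \<open>f\<close> by injectivity. Whatever is preserved by postcomposition thus passes from one
  injection to all others.\<close>

lemma FI_hom_transitive:
  assumes f: "f \<in> FI_hom m n" and g: "g \<in> FI_hom m n"
  obtains \<sigma> where "\<sigma> \<in> FI_hom n n" "compose {1..m} \<sigma> f = g"
proof -
  have inj: "inj_on f {1..m}" "inj_on g {1..m}" using f g by (simp_all add: FI_hom_def)
  have "inj_on (\<lambda>j. g (inv_into {1..m} f j)) (f ` {1..m})"
  proof (rule inj_onI)
    fix a b assume "a \<in> f ` {1..m}" "b \<in> f ` {1..m}"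
      and eq: "g (inv_into {1..m} f a) = g (inv_into {1..m} f b)"
    then obtain i j where ij: "i \<in> {1..m}" "j \<in> {1..m}" "a = f i" "b = f j" by blast
    with eq have "g i = g j" using inv_into_f_f[OF inj(1)] by metis
    with ij show "a = b" using inj_onD[OF inj(2)] by blast
  qed
  moreover have "f ` {1..m} \<subseteq> {1..n}"
    "(\<lambda>j. g (inv_into {1..m} f j)) ` f ` {1..m} \<subseteq> {1..n}"
    using f g inv_into_f_f[OF inj(1)] by (fastforce simp: FI_hom_def PiE_iff)+
  ultimately obtain \<sigma> where \<sigma>: "\<sigma> \<in> FI_hom n n"
    "\<And>i. i \<in> f ` {1..m} \<Longrightarrow> \<sigma> i = g (inv_into {1..m} f i)"
    using FI_hom_extend[of "f ` {1..m}" n "\<lambda>j. g (inv_into {1..m} f j)"] by blast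
  have "compose {1..m} \<sigma> f = g"
  proof (rule compose_eq_FI_homI[OF g])
    fix i assume "i \<in> {1..m}"
    then show "\<sigma> (f i) = g i" using \<sigma>(2)[of "f i"] inv_into_f_f[OF inj(1), of i] by simp
  qed
  with \<sigma> that show ?thesis by blast
qed

text \<open>The relative position of \<open>g\<close> and the inclusion \<open>[D] \<subseteq> [n]\<close>, i.e. the isomorphism type of
  this pair of injections; \<open>0\<close> stands for a value outside \<open>[D]\<close>.\<close>

definition overlap :: "nat \<Rightarrow> (nat \<Rightarrow> nat) \<Rightarrow> nat \<Rightarrow> nat" where
  "overlap D g = (\<lambda>i\<in>{1..D}. if g i \<le> D then g i else 0)"

lemma overlap_in: "overlap D g \<in> {1..D} \<rightarrow>\<^sub>E {0..D}"
  by (auto simp: overlap_def)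

text \<open>The permutation is prescribed on [D] and on the image of \<open>g\<close>. The
  prescriptions are compatible, since equal overlaps make \<open>g\<close> and \<open>g'\<close>
  agree wherever either lands in [D], and jointly injective, since values outside [D] go outside
  [D].\<close>

lemma overlap_transitive:
  assumes g: "g \<in> FI_hom D n" and g': "g' \<in> FI_hom D n" and "D \<le> n"
    and eq: "overlap D g = overlap D g'"
  obtains \<sigma> where "\<sigma> \<in> FI_hom n n" "compose {1..D} \<sigma> g = g'"
    "compose {1..D} \<sigma> (\<lambda>i\<in>{1..D}. i) = (\<lambda>i\<in>{1..D}. i)"
proof -
  have inj: "inj_on g {1..D}" "inj_on g' {1..D}"
    and g_in: "\<And>i. i \<in> {1..D} \<Longrightarrow> g i \<in> {1..n}" and g'_in: "\<And>i. i \<in> {1..D} \<Longrightarrow> g' i \<in> {1..n}"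
    using g g' by (auto simp: FI_hom_def PiE_iff)
  have same: "if g i \<le> D then g' i = g i else D < g' i" if "i \<in> {1..D}" for i
    using fun_cong[OF eq, of i] that g_in[OF that] g'_in[OF that]
    by (auto simp: overlap_def split: if_splits)
  define A where "A = {1..D} \<union> g ` {1..D}"
  define h where "h j = (if j \<le> D then j else g' (inv_into {1..D} g j))" for j
  have hg: "h (g i) = g' i" if "i \<in> {1..D}" for i
    using same[OF that] inv_into_f_f[OF inj(1) that] by (auto simp: h_def split: if_splits)
  have hD: "h i = i" if "i \<le> D" for i using that by (simp add: h_def)
  have h_big: "D < h (g i)" if "i \<in> {1..D}" "D < g i" for i
    using same[OF that(1)] hg[OF that(1)] that by auto
  have "inj_on h A"
  proof (rule inj_onI)
    fix a b assume ab: "a \<in> A" "b \<in> A" "h a = h b"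
    have big: "D < h c" "\<exists>i\<in>{1..D}. c = g i" if "c \<in> A" "D < c" for c
      using that h_big by (auto simp: A_def)
    consider "a \<le> D" "b \<le> D" | "a \<le> D" "D < b" | "D < a" "b \<le> D" | "D < a" "D < b" by linarith
    then show "a = b"
    proof cases
      case 4
      then obtain i j where "i \<in> {1..D}" "j \<in> {1..D}" "a = g i" "b = g j" using big ab by metis
      with ab(3) hg inj(2) show ?thesis by (simp add: inj_on_eq_iff)
    next
      case 2
      then show ?thesis using ab hD[of a] big(1)[of b] by simp
    next
      case 3
      then show ?thesis using ab hD[of b] big(1)[of a] by simp
    qed (use ab hD in simp)
  qed
  moreover have "h ` A \<subseteq> {1..n}" "A \<subseteq> {1..n}"
    using hg hD g_in g'_in \<open>D \<le> n\<close> by (auto simp: A_def)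
  ultimately obtain \<sigma> where \<sigma>: "\<sigma> \<in> FI_hom n n" "\<And>i. i \<in> A \<Longrightarrow> \<sigma> i = h i"
    using FI_hom_extend[of A n h] by blast
  have "compose {1..D} \<sigma> g = g'"
  proof (rule compose_eq_FI_homI[OF g'])
    fix i assume "i \<in> {1..D}"
    then show "\<sigma> (g i) = g' i" using \<sigma>(2)[of "g i"] hg by (simp add: A_def)
  qed
  moreover have "compose {1..D} \<sigma> (\<lambda>i\<in>{1..D}. i) = (\<lambda>i\<in>{1..D}. i)"
    using \<sigma>(2) hD
    by (intro compose_eq_FI_homI[OF inclusion_in_FI_hom[OF \<open>D \<le> n\<close>]]) (simp add: A_def)
  ultimately show ?thesis using \<sigma>(1) that by blast
qed

text \<open>An injection with overlap \<open>\<tau>\<close> is prescribed where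
  \<open>\<tau>\<close> is nonzero and is an arbitrary injection into {D+1..n} on the remaining
  positions \<open>Z\<close>, so a falling factorial counts these. If \<open>\<tau>\<close> never
  occurs, the count is zero.\<close>

lemma eventually_polynomial_card_overlap:
  "eventually_polynomial (\<lambda>n. of_nat (card {g \<in> FI_hom D n. overlap D g = \<tau>}))"
proof -
  define Z where "Z = {i \<in> {1..D}. \<tau> i = 0}"
  show ?thesis
  proof (cases "\<exists>n. \<exists>g \<in> FI_hom D n. overlap D g = \<tau>")
    case True
    then obtain n0 g0 where g0: "g0 \<in> FI_hom D n0" "overlap D g0 = \<tau>" by blast
    have \<tau>: "\<tau> \<in> {1..D} \<rightarrow>\<^sub>E {0..D}" using g0 overlap_in by blast
    \<comment> \<open>An overlap that occurs is injective where it is nonzero; this keeps the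
      filled-in map \<open>?ext f\<close> below from repeating a prescribed value.\<close>
    have \<tau>_inj: "i = j" if "i \<in> {1..D}" "j \<in> {1..D}" "\<tau> i \<noteq> 0" "\<tau> i = \<tau> j" for i j
    proof -
      have "\<tau> i = g0 i" "\<tau> j = g0 j"
        using that unfolding g0(2)[symmetric] by (auto simp: overlap_def split: if_splits)
      with that g0(1) show ?thesis using inj_onD[of g0 "{1..D}" i j] by (simp add: FI_hom_def)
    qed
    let ?ext = "\<lambda>f::nat \<Rightarrow> nat. \<lambda>i\<in>{1..D}. if \<tau> i = 0 then f i else \<tau> i"
    let ?res = "\<lambda>g::nat \<Rightarrow> nat. restrict g Z"
    have "card {f \<in> Z \<rightarrow>\<^sub>E {D<..n}. inj_on f Z} = card {g \<in> FI_hom D n. overlap D g = \<tau>}"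
      if "D \<le> n" for n
    proof (rule bij_betw_same_card, rule bij_betw_byWitness[where f = ?ext and f' = ?res])
      show "\<forall>f\<in>{f \<in> Z \<rightarrow>\<^sub>E {D<..n}. inj_on f Z}. ?res (?ext f) = f"
      proof (intro ballI ext)
        fix f i assume "f \<in> {f \<in> Z \<rightarrow>\<^sub>E {D<..n}. inj_on f Z}"
        then have "f \<in> Z \<rightarrow>\<^sub>E {D<..n}" by blast
        then show "?res (?ext f) i = f i"
          using PiE_arb[of f Z _ i] by (cases "i \<in> Z") (simp_all add: Z_def)
      qed
      show "\<forall>g\<in>{g \<in> FI_hom D n. overlap D g = \<tau>}. ?ext (?res g) = g"
      proof (intro ballI ext)
        fix g i assume "g \<in> {g \<in> FI_hom D n. overlap D g = \<tau>}"
        then have g: "g \<in> {1..D} \<rightarrow>\<^sub>E {1..n}" "\<tau> = overlap D g" by (auto simp: FI_hom_def)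
        show "?ext (?res g) i = g i"
        proof (cases "i \<in> {1..D}")
          case True
          then show ?thesis
            by (simp add: Z_def) (simp add: g(2) overlap_def)
        next
          case False
          then show ?thesis using PiE_arb[OF g(1), of i] by auto
        qed
      qed
      show "?ext ` {f \<in> Z \<rightarrow>\<^sub>E {D<..n}. inj_on f Z} \<subseteq> {g \<in> FI_hom D n. overlap D g = \<tau>}"
      proof (intro image_subsetI CollectI conjI)
        fix f assume "f \<in> {f \<in> Z \<rightarrow>\<^sub>E {D<..n}. inj_on f Z}"
        then have f: "\<And>i. i \<in> Z \<Longrightarrow> D < f i \<and> f i \<le> n" "inj_on f Z" by (auto simp: PiE_iff)
        have \<tau>_le: "\<tau> i \<le> D" if "i \<in> {1..D}" for i using \<tau> that by (auto simp: PiE_iff)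
        have "inj_on (?ext f) {1..D}"
        proof (rule inj_onI)
          fix i j assume ij: "i \<in> {1..D}" "j \<in> {1..D}" "?ext f i = ?ext f j"
          show "i = j"
          proof (cases "\<tau> i = 0 \<longleftrightarrow> \<tau> j = 0")
            case True
            then show ?thesis
              using ij f(2) \<tau>_inj[OF ij(1,2)] by (auto simp: Z_def inj_on_def split: if_splits)
          next
            case False
            then show ?thesis
              using ij f(1)[of i] f(1)[of j] \<tau>_le[OF ij(1)] \<tau>_le[OF ij(2)]
              by (auto simp: Z_def split: if_splits)
          qed
        qed
        moreover have "?ext f i \<in> {1..n}" if "i \<in> {1..D}" for i
          using f(1)[of i] \<tau>_le[OF that] that \<open>D \<le> n\<close> by (auto simp: Z_def)
        ultimately show "?ext f \<in> FI_hom D n" by (auto simp: FI_hom_def)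
        show "overlap D (?ext f) = \<tau>"
        proof
          fix i
          show "overlap D (?ext f) i = \<tau> i"
          proof (cases "i \<in> {1..D}")
            case True
            then show ?thesis
              using f(1)[of i] \<tau>_le[of i] by (cases "\<tau> i = 0") (simp_all add: overlap_def Z_def)
          next
            case False
            then show ?thesis using PiE_arb[OF \<tau>, of i] by (auto simp: overlap_def)
          qed
        qed
      qed
      show "?res ` {g \<in> FI_hom D n. overlap D g = \<tau>} \<subseteq> {f \<in> Z \<rightarrow>\<^sub>E {D<..n}. inj_on f Z}"
      proof (intro image_subsetI CollectI conjI)
        fix g assume "g \<in> {g \<in> FI_hom D n. overlap D g = \<tau>}"
        then have g: "g \<in> {1..D} \<rightarrow>\<^sub>E {1..n}" "inj_on g {1..D}" "\<tau> = overlap D g"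
          by (auto simp: FI_hom_def)
        have "D < g i \<and> g i \<le> n" if "i \<in> Z" for i
        proof -
          have "i \<in> {1..D}" "\<tau> i = 0" using that by (simp_all add: Z_def)
          moreover from this have "g i \<in> {1..n}" using g(1) by blast
          ultimately show ?thesis by (simp add: g(3) overlap_def split: if_splits)
        qed
        then show "?res g \<in> Z \<rightarrow>\<^sub>E {D<..n}" by simp
        show "inj_on (?res g) Z"
          unfolding inj_on_restrict_eq by (rule inj_on_subset[OF g(2)]) (auto simp: Z_def)
      qed
    qed
    then have ev: "\<forall>\<^sub>F n in sequentially. rat_of_nat (card {f \<in> Z \<rightarrow>\<^sub>E {D<..n}. inj_on f Z}) =
        of_nat (card {g \<in> FI_hom D n. overlap D g = \<tau>})"
      by (intro eventually_sequentiallyI[of D]) simp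
    have "finite Z" by (simp add: Z_def)
    then show ?thesis
      by (rule eventually_polynomial_cong[OF eventually_polynomial_card_inj ev])
  next
    case False
    then have "{g \<in> FI_hom D n. overlap D g = \<tau>} = {}" for n by auto
    then show ?thesis using eventually_polynomial_const[of 0] by (simp only: card.empty of_nat_0)
  qed
qed

lemma eventually_polynomial_card_FI_hom: "eventually_polynomial (\<lambda>n. of_nat (card (FI_hom D n)))"
proof -
  have "{0<..n} = {1..n}" for n :: nat by auto
  then show ?thesis
    using eventually_polynomial_card_inj[of "{1..D}" 0] by (simp add: FI_hom_def)
qed

text \<open>The images of all \<open>g u\<close> together have at most \<open>card A * d\<close>
  points, so a set of exactly that size contains them, and an enumeration \<open>f\<close> of this
  set factors every \<open>g u\<close>.\<close>

lemma FI_hom_common_factor: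
  assumes "finite A" "card A * d \<le> n" and g: "\<And>u. u \<in> A \<Longrightarrow> g u \<in> FI_hom d n"
  obtains f k where "f \<in> FI_hom (card A * d) n"
    "\<And>u. u \<in> A \<Longrightarrow> k u \<in> FI_hom d (card A * d)"
    "\<And>u. u \<in> A \<Longrightarrow> compose {1..d} f (k u) = g u"
proof -
  define D where "D = card A * d"
  define U where "U = (\<Union>u\<in>A. g u ` {1..d})"
  have g_inj: "inj_on (g u) {1..d}" and g_in: "g u ` {1..d} \<subseteq> {1..n}" if "u \<in> A" for u
    using g[OF that] by (auto simp: FI_hom_def)
  have "card U \<le> (\<Sum>u\<in>A. card (g u ` {1..d}))"
    unfolding U_def using assms(1) by (rule card_UN_le)
  also have "\<dots> = D" using g_inj by (simp add: card_image D_def)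
  finally have "card U \<le> D" .
  moreover have "U \<subseteq> {1..n}" using g_in by (auto simp: U_def)
  \<comment> \<open>The union may be too small, so it is padded to exactly \<open>D\<close> points
    inside [n], which has room because D \<le> n.\<close>
  ultimately obtain U' where U': "U \<subseteq> U'" "U' \<subseteq> {1..n}" "card U' = D"
    using exists_subset_between[of U D "{1..n}"] assms(2) by (auto simp: D_def)
  then have "finite U'" using finite_subset by blast
  then obtain f0 where f0: "bij_betw f0 {1..D} U'"
    using finite_same_card_bij[of "{1..D}" U'] U' by auto
  define f where "f = restrict f0 {1..D}"
  have f: "bij_betw f {1..D} U'" using f0 by (simp add: f_def bij_betw_restrict_eq)
  have f_hom: "f \<in> FI_hom D n"
    using f U'(2) bij_betw_apply[OF f0] by (auto simp: FI_hom_def f_def bij_betw_def)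
  define k where "k u = (\<lambda>i\<in>{1..d}. inv_into {1..D} f (g u i))" for u
  have in_U': "g u i \<in> U'" if "u \<in> A" "i \<in> {1..d}" for u i
    using that U'(1) unfolding U_def by blast
  have fk: "f (k u i) = g u i" "k u i \<in> {1..D}" if "u \<in> A" "i \<in> {1..d}" for u i
    using bij_betw_inv_into_right[OF f in_U'[OF that]]
      bij_betw_apply[OF bij_betw_inv_into[OF f] in_U'[OF that]] that
    by (simp_all add: k_def)
  have k_hom: "k u \<in> FI_hom d D" if "u \<in> A" for u
  proof -
    have "inj_on (k u) {1..d}"
    proof (rule inj_onI)
      fix i j assume ij: "i \<in> {1..d}" "j \<in> {1..d}" "k u i = k u j"
      then have "g u i = g u j" using fk(1)[OF that] by metis
      with ij show "i = j" using g_inj[OF that] by (auto dest: inj_onD)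
    qed
    moreover have "k u \<in> {1..d} \<rightarrow>\<^sub>E {1..D}"
      using fk(2)[OF that] by (intro PiE_I) (blast, simp only: k_def restrict_apply if_False)
    ultimately show ?thesis by (simp add: FI_hom_def)
  qed
  have k_comp: "compose {1..d} f (k u) = g u" if "u \<in> A" for u
    using g[OF that] fk(1)[OF that] by (rule compose_eq_FI_homI)
  show ?thesis
    by (rule that[folded D_def, OF f_hom k_hom k_comp])
qed

subsection \<open>Counting classes of labelled injections\<close>

text \<open>The pairs \<open>(g, y)\<close> with the same image as \<open>(f, x)\<close> number the same for every \<open>f\<close>, so that
  \<open>f\<close> may be taken to be the inclusion; then whether \<open>(g, y)\<close> is among them depends only on
  \<open>x\<close>, \<open>y\<close> and the overlap of \<open>g\<close>, and for each of these finitely many data it can only change from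
  false to true as \<open>n\<close> grows.\<close>

lemma eventually_rational_card_quotient:
  fixes \<Phi> :: "nat \<Rightarrow> (nat \<Rightarrow> nat) \<Rightarrow> 'i \<Rightarrow> 'c"
  assumes fin: "finite J"
    and compat: "\<And>n m f g h x y. \<lbrakk>f \<in> FI_hom D n; g \<in> FI_hom D n; h \<in> FI_hom n m; x \<in> J; y \<in> J;
      \<Phi> n f x = \<Phi> n g y\<rbrakk> \<Longrightarrow> \<Phi> m (compose {1..D} h f) x = \<Phi> m (compose {1..D} h g) y"
  shows "eventually_rational (\<lambda>n. of_nat (card ((\<lambda>(f, x). \<Phi> n f x) ` (FI_hom D n \<times> J))))"
proof -
  define \<iota> where "\<iota> = (\<lambda>i\<in>{1..D}. i)"
  \<comment> \<open>\<open>fib n f x y\<close> collects the injections that, with label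
    \<open>y\<close>, give the same class as (f, x). \<open>E\<close> records which overlaps occur
    among those for the inclusion, and \<open>c n x\<close> will be the size of a whole fibre of the
    quotient map.\<close>
  define fib where "fib n f x y = {g \<in> FI_hom D n. \<Phi> n g y = \<Phi> n f x}" for n f x y
  define E where "E n x y \<tau> \<longleftrightarrow> (\<exists>g \<in> FI_hom D n. overlap D g = \<tau> \<and> \<Phi> n g y = \<Phi> n \<iota> x)" for n x y \<tau>
  define c where "c n x = (\<Sum>y\<in>J. card (fib n \<iota> x y))" for n x
  have \<iota>: "\<iota> \<in> FI_hom D n" if "D \<le> n" for n
    using inclusion_in_FI_hom[OF that] by (simp add: \<iota>_def)

  \<comment> \<open>Postcomposition with a permutation taking \<open>f\<close> to \<open>f'\<close>
    maps one fibre injectively into the other, by \<open>compat\<close>; exchanging \<open>f\<close>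
    and \<open>f'\<close> then gives equality.\<close>
  have fib_le: "card (fib n f x y) \<le> card (fib n f' x y)"
    if f: "f \<in> FI_hom D n" "f' \<in> FI_hom D n" and xy: "x \<in> J" "y \<in> J" for n f f' x y
  proof -
    obtain \<sigma> where \<sigma>: "\<sigma> \<in> FI_hom n n" "compose {1..D} \<sigma> f = f'"
      by (rule FI_hom_transitive[OF f])
    show ?thesis
    proof (rule card_inj_on_le)
      show "finite (fib n f' x y)" using finite_FI_hom by (simp add: fib_def)
      show "compose {1..D} \<sigma> ` fib n f x y \<subseteq> fib n f' x y"
        using FI_hom_compose[OF _ \<sigma>(1)] compat[OF _ f(1) \<sigma>(1) xy(2,1)] \<sigma>(2) by (auto simp: fib_def)
      show "inj_on (compose {1..D} \<sigma>) (fib n f x y)"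
      proof (rule inj_onI)
        fix g g' assume "g \<in> fib n f x y" "g' \<in> fib n f x y"
          and eq: "compose {1..D} \<sigma> g = compose {1..D} \<sigma> g'"
        then have g: "g \<in> {1..D} \<rightarrow>\<^sub>E {1..n}" "g' \<in> {1..D} \<rightarrow>\<^sub>E {1..n}"
          by (auto simp: fib_def FI_hom_def)
        show "g = g'"
        proof (rule PiE_ext[OF g])
          fix i assume i: "i \<in> {1..D}"
          have "\<sigma> (g i) = \<sigma> (g' i)" using fun_cong[OF eq, of i] i by (simp add: compose_eq)
          moreover have "g i \<in> {1..n}" "g' i \<in> {1..n}" using g i by blast+
          ultimately show "g i = g' i" using \<sigma>(1) by (auto simp: FI_hom_def dest: inj_onD)
        qed
      qed
    qed
  qed

  \<comment> \<open>Since the fibre of (f, x) has size \<open>c n x\<close> whatever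
    \<open>f\<close> is, fibre counting collapses to a sum over \<open>J\<close>.\<close>
  have card_eq: "rat_of_nat (card ((\<lambda>(f, x). \<Phi> n f x) ` (FI_hom D n \<times> J))) =
      (\<Sum>x\<in>J. of_nat (card (FI_hom D n)) / of_nat (c n x))" if "D \<le> n" for n
  proof -
    let ?Y = "FI_hom D n \<times> J" and ?F = "\<lambda>(f, x). \<Phi> n f x"
    have fibre: "card {w \<in> ?Y. ?F w = ?F (f, x)} = c n x" if "f \<in> FI_hom D n" "x \<in> J" for f x
    proof -
      have "{w \<in> ?Y. ?F w = ?F (f, x)} = (\<lambda>(y, g). (g, y)) ` (SIGMA y:J. fib n f x y)"
        by (auto simp: fib_def)
      then have "card {w \<in> ?Y. ?F w = ?F (f, x)} = card (SIGMA y:J. fib n f x y)"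
        by (simp add: card_image inj_on_def)
      also have "\<dots> = (\<Sum>y\<in>J. card (fib n f x y))"
        using fin finite_FI_hom by (simp add: fib_def)
      also have "\<dots> = c n x"
        unfolding c_def using that \<iota>[OF \<open>D \<le> n\<close>] fib_le by (intro sum.cong) (auto intro: antisym)
      finally show ?thesis .
    qed
    have "rat_of_nat (card (?F ` ?Y)) = (\<Sum>z\<in>?Y. 1 / of_nat (card {w \<in> ?Y. ?F w = ?F z}))"
      by (rule card_image_eq_sum_inverse_fibres) (simp add: fin finite_FI_hom)
    also have "\<dots> = (\<Sum>(f, x)\<in>?Y. 1 / of_nat (c n x))"
      using fibre by (intro sum.cong) auto
    also have "\<dots> = (\<Sum>f\<in>FI_hom D n. \<Sum>x\<in>J. 1 / of_nat (c n x))"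
      by (rule sum.cartesian_product[symmetric])
    also have "\<dots> = (\<Sum>x\<in>J. of_nat (card (FI_hom D n)) / of_nat (c n x))"
      by (simp add: sum_distrib_left)
    finally show ?thesis .
  qed

  \<comment> \<open>The inclusion of [n] in [n+1] changes no value of an injection, so overlaps and
    \<open>\<iota>\<close> stay the same, while \<open>compat\<close> preserves the coincidence of
    classes.\<close>
  have E_Suc: "E (Suc n) x y \<tau>" if n: "D \<le> n" and xy: "x \<in> J" "y \<in> J" and E: "E n x y \<tau>" for n x y \<tau>
  proof -
    from E obtain g where g: "g \<in> FI_hom D n" "overlap D g = \<tau>" "\<Phi> n g y = \<Phi> n \<iota> x"
      by (auto simp: E_def)
    define h where "h = (\<lambda>i\<in>{1..n}. i)"
    have h: "h \<in> FI_hom n (Suc n)" by (simp add: h_def inclusion_in_FI_hom)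
    have hg: "compose {1..D} h k i = k i" if "k \<in> FI_hom D n" "i \<in> {1..D}" for k i
    proof -
      have "k i \<in> {1..n}" using that by (auto simp: FI_hom_def)
      with that show ?thesis by (simp add: compose_eq h_def)
    qed
    have "compose {1..D} h \<iota> = \<iota>"
      using \<iota>[of n] \<iota>[of "Suc n"] n hg by (intro compose_eq_FI_homI) (auto simp: compose_eq)
    moreover have "overlap D (compose {1..D} h g) = \<tau>"
      unfolding g(2)[symmetric] overlap_def using hg[OF g(1)] by (auto simp: fun_eq_iff)
    ultimately show ?thesis
      using compat[OF g(1) \<iota>[OF n] h xy(2,1) g(3)] FI_hom_compose[OF g(1) h] by (auto simp: E_def)
  qed
  \<comment> \<open>A permutation fixing [D] pointwise moves a witness \<open>g'\<close> with the
    same overlap onto \<open>g\<close>, and \<open>compat\<close> carries the coincidence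
    along.\<close>
  have E_iff: "E n x y (overlap D g) \<longleftrightarrow> \<Phi> n g y = \<Phi> n \<iota> x"
    if n: "D \<le> n" and xy: "x \<in> J" "y \<in> J" and g: "g \<in> FI_hom D n" for n x y g
  proof
    assume "E n x y (overlap D g)"
    then obtain g' where g': "g' \<in> FI_hom D n" "overlap D g' = overlap D g" "\<Phi> n g' y = \<Phi> n \<iota> x"
      by (auto simp: E_def)
    obtain \<sigma> where "\<sigma> \<in> FI_hom n n" "compose {1..D} \<sigma> g' = g" "compose {1..D} \<sigma> \<iota> = \<iota>"
      using overlap_transitive[OF g'(1) g n g'(2)] unfolding \<iota>_def by blast
    with compat[OF g'(1) \<iota>[OF n] _ xy(2,1) g'(3)] show "\<Phi> n g y = \<Phi> n \<iota> x" by metis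
  qed (use g in \<open>auto simp: E_def\<close>)

  \<comment> \<open>Beyond a threshold common to the finitely many overlaps, the fibre is the
    disjoint union of the overlap classes on which \<open>E\<close> has become true.\<close>
  have fib_polynomial: "eventually_polynomial (\<lambda>n. of_nat (card (fib n \<iota> x y)))"
    if xy: "x \<in> J" "y \<in> J" for x y
  proof -
    define P where "P = ({1..D} \<rightarrow>\<^sub>E {0..D})"
    have finP: "finite P" by (auto simp: P_def intro: finite_PiE)
    have "\<forall>\<tau>. \<exists>b. \<forall>\<^sub>F n in sequentially. E n x y \<tau> \<longleftrightarrow> b"
      using E_Suc[OF _ xy] by (intro allI eventually_constant_if_mono[of D]) auto
    then obtain E' where E': "\<And>\<tau>. \<forall>\<^sub>F n in sequentially. E n x y \<tau> \<longleftrightarrow> E' \<tau>" by metis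
    have "\<forall>\<^sub>F n in sequentially. \<forall>\<tau>\<in>P. E n x y \<tau> \<longleftrightarrow> E' \<tau>"
      using E' by (intro eventually_ball_finite[OF finP]) auto
    then have "\<forall>\<^sub>F n in sequentially. (\<Sum>\<tau>\<in>{\<tau> \<in> P. E' \<tau>}.
        of_nat (card {g \<in> FI_hom D n. overlap D g = \<tau>})) = rat_of_nat (card (fib n \<iota> x y))"
      using eventually_ge_at_top[of D]
    proof eventually_elim
      case (elim n)
      have "fib n \<iota> x y = (\<Union>\<tau>\<in>{\<tau> \<in> P. E' \<tau>}. {g \<in> FI_hom D n. overlap D g = \<tau>})"
        using E_iff[OF elim(2) xy] elim(1) overlap_in by (auto simp: fib_def P_def)
      also have "card \<dots> = (\<Sum>\<tau>\<in>{\<tau> \<in> P. E' \<tau>}. card {g \<in> FI_hom D n. overlap D g = \<tau>})"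
        using finP finite_FI_hom by (intro card_UN_disjoint) auto
      finally show ?case by simp
    qed
    then show ?thesis
      by (rule eventually_polynomial_cong[OF eventually_polynomial_sum, rotated -1])
        (use finP in \<open>simp_all add: eventually_polynomial_card_overlap\<close>)
  qed
  have "eventually_polynomial (\<lambda>n. \<Sum>y\<in>J. of_nat (card (fib n \<iota> x y)))" if "x \<in> J" for x
    using fin fib_polynomial[OF that] by (rule eventually_polynomial_sum)
  then have c_polynomial: "eventually_polynomial (\<lambda>n. of_nat (c n x))" if "x \<in> J" for x
    using that by (simp add: c_def)
  \<comment> \<open>The inclusion with label \<open>x\<close> lies in its own fibre.\<close>
  have "c n x \<noteq> 0" if "D \<le> n" "x \<in> J" for n x
  proof -
    have "\<iota> \<in> fib n \<iota> x x" using \<iota>[OF that(1)] by (simp add: fib_def)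
    then have "card (fib n \<iota> x x) \<noteq> 0" using finite_FI_hom by (auto simp: fib_def)
    with that(2) fin show ?thesis by (auto simp: c_def)
  qed
  then have c_nonzero: "\<forall>\<^sub>F n in sequentially. rat_of_nat (c n x) \<noteq> 0" if "x \<in> J" for x
    using that by (intro eventually_sequentiallyI[of D]) simp
  have "eventually_rational (\<lambda>n. \<Sum>x\<in>J. of_nat (card (FI_hom D n)) / of_nat (c n x))"
    using fin by (rule eventually_rational_sum)
      (intro eventually_rational_divide eventually_polynomial_card_FI_hom c_polynomial c_nonzero)
  then show ?thesis
    by (rule eventually_rational_cong) (rule eventually_sequentiallyI[of D], simp only: card_eq)
qed

subsection \<open>Copies of a graph\<close>

definition image_graph :: "('b \<Rightarrow> 'a) \<Rightarrow> 'b ugraph \<Rightarrow> 'a ugraph" where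
  "image_graph \<psi> H = \<lparr>verts = \<psi> ` verts H, edges = (`) \<psi> ` edges H\<rparr>"

lemma image_graph_comp: "image_graph (\<lambda>u. \<chi> (\<psi> u)) H = image_graph \<chi> (image_graph \<psi> H)"
  by (auto simp: image_graph_def image_image)

lemma image_graph_cong:
  assumes "simple_graph H" "\<And>u. u \<in> verts H \<Longrightarrow> \<psi> u = \<chi> u"
  shows "image_graph \<psi> H = image_graph \<chi> H"
proof -
  have "\<psi> ` e = \<chi> ` e" if "e \<in> edges H" for e
    using assms that by (intro image_cong) (auto simp: simple_graph_def)
  with assms(2) show ?thesis by (simp add: image_graph_def)
qed

lemma simple_graph_edgeE:
  assumes "simple_graph H" "e \<in> edges H"
  obtains u v where "e = {u, v}" "u \<in> verts H" "v \<in> verts H" "u \<noteq> v"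
  using assms by (auto simp: simple_graph_def card_2_iff)

text \<open>Edges are preserved but not reflected, since copies need not be induced.\<close>

definition embeds :: "('b \<Rightarrow> 'a) \<Rightarrow> 'b ugraph \<Rightarrow> 'a ugraph \<Rightarrow> bool" where
  "embeds \<psi> H G \<longleftrightarrow> \<psi> ` verts H \<subseteq> verts G \<and> inj_on \<psi> (verts H) \<and> (`) \<psi> ` edges H \<subseteq> edges G"

lemma embeds_cong:
  assumes "simple_graph H" "\<And>u. u \<in> verts H \<Longrightarrow> \<psi> u = \<chi> u"
  shows "embeds \<psi> H G \<longleftrightarrow> embeds \<chi> H G"
proof -
  have "(`) \<psi> ` edges H = (`) \<chi> ` edges H" "\<psi> ` verts H = \<chi> ` verts H"
    using image_graph_cong[OF assms] by (auto simp: image_graph_def)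
  moreover have "inj_on \<psi> (verts H) \<longleftrightarrow> inj_on \<chi> (verts H)"
    by (rule inj_on_cong) (rule assms(2))
  ultimately show ?thesis by (simp add: embeds_def)
qed

text \<open>Injectivity keeps the image of an edge two-element and lets the edge be recovered from
  its image, so the inverse of \<open>\<psi>\<close> is an isomorphism back to
  \<open>H\<close>.\<close>

lemma image_graph_in_subgraphs:
  assumes H: "simple_graph H" and \<psi>: "embeds \<psi> H G"
  shows "image_graph \<psi> H \<in> subgraphs G" "graph_iso (image_graph \<psi> H) H"
proof -
  have inj: "inj_on \<psi> (verts H)" using \<psi> by (simp add: embeds_def)
  have sub: "e \<subseteq> verts H" "card e = 2" if "e \<in> edges H" for e
    using H that by (auto simp: simple_graph_def)
  have "card (\<psi> ` e) = 2" if "e \<in> edges H" for e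
    using card_image[OF inj_on_subset[OF inj sub(1)[OF that]]] sub(2)[OF that] by simp
  then have "simple_graph (image_graph \<psi> H)"
    using H sub by (auto simp: simple_graph_def image_graph_def)
  with \<psi> show "image_graph \<psi> H \<in> subgraphs G"
    by (simp add: subgraphs_def embeds_def image_graph_def)
  define \<phi> where "\<phi> = inv_into (verts H) \<psi>"
  have \<phi>: "\<phi> (\<psi> u) = u" if "u \<in> verts H" for u using inj that by (simp add: \<phi>_def)
  have "bij_betw \<phi> (\<psi> ` verts H) (verts H)"
    unfolding \<phi>_def by (rule bij_betw_inv_into) (simp add: inj_on_imp_bij_betw inj)
  moreover have "\<psi> ` {u, v} \<in> (`) \<psi> ` edges H \<longleftrightarrow> {u, v} \<in> edges H" if "u \<in> verts H" "v \<in> verts H" for u v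
  proof
    assume "\<psi> ` {u, v} \<in> (`) \<psi> ` edges H"
    then obtain e where e: "e \<in> edges H" "\<psi> ` {u, v} = \<psi> ` e" by blast
    with inj_on_image_eq_iff[OF inj, of "{u, v}" e] sub(1) that have "{u, v} = e" by auto
    with e show "{u, v} \<in> edges H" by simp
  qed (rule imageI)
  ultimately show "graph_iso (image_graph \<psi> H) H"
    unfolding graph_iso_def image_graph_def by (intro exI[of _ \<phi>]) (auto simp: \<phi>)
qed

text \<open>The inverse of an isomorphism from \<open>K\<close> to \<open>H\<close>, read as a map
  into \<open>G\<close>, is the embedding.\<close>

lemma subgraph_is_image_graph:
  assumes H: "simple_graph H" and K: "K \<in> subgraphs G" "graph_iso K H"
  obtains \<psi> where "embeds \<psi> H G" "K = image_graph \<psi> H"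
proof -
  have Ks: "simple_graph K" "verts K \<subseteq> verts G" "edges K \<subseteq> edges G"
    using K(1) by (auto simp: subgraphs_def)
  obtain \<phi> where \<phi>: "bij_betw \<phi> (verts K) (verts H)"
    "\<And>x y. x \<in> verts K \<Longrightarrow> y \<in> verts K \<Longrightarrow> {x, y} \<in> edges K \<longleftrightarrow> {\<phi> x, \<phi> y} \<in> edges H"
    using K(2) by (auto simp: graph_iso_def)
  define \<psi> where "\<psi> = inv_into (verts K) \<phi>"
  have \<psi>: "bij_betw \<psi> (verts H) (verts K)"
    unfolding \<psi>_def using \<phi>(1) by (rule bij_betw_inv_into)
  have \<phi>\<psi>: "\<phi> (\<psi> u) = u" "\<psi> u \<in> verts K" if "u \<in> verts H" for u
    using \<phi>(1) \<psi> that by (auto simp: \<psi>_def bij_betw_inv_into_right bij_betw_apply)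
  have \<psi>\<phi>: "\<psi> (\<phi> x) = x" "\<phi> x \<in> verts H" if "x \<in> verts K" for x
    using \<phi>(1) that by (auto simp: \<psi>_def bij_betw_inv_into_left bij_betw_apply)
  have edges: "(`) \<psi> ` edges H = edges K"
  proof (intro equalityI subsetI)
    fix e assume "e \<in> (`) \<psi> ` edges H"
    then obtain e' where e': "e = \<psi> ` e'" "e' \<in> edges H" by blast
    obtain u v where "e' = {u, v}" "u \<in> verts H" "v \<in> verts H"
      using H e'(2) by (rule simple_graph_edgeE)
    with e' \<phi>(2)[of "\<psi> u" "\<psi> v"] \<phi>\<psi> show "e \<in> edges K" by simp
  next
    fix e assume e: "e \<in> edges K"
    obtain x y where xy: "e = {x, y}" "x \<in> verts K" "y \<in> verts K"
      using Ks(1) e by (rule simple_graph_edgeE)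
    then have "e = \<psi> ` {\<phi> x, \<phi> y}" "{\<phi> x, \<phi> y} \<in> edges H" using \<psi>\<phi> \<phi>(2) e by auto
    then show "e \<in> (`) \<psi> ` edges H" by blast
  qed
  have verts: "\<psi> ` verts H = verts K" using \<psi> by (simp add: bij_betw_def)
  have "embeds \<psi> H G"
    using \<psi> Ks verts edges by (simp add: embeds_def bij_betw_def)
  moreover have "K = image_graph \<psi> H"
    by (simp add: image_graph_def verts edges)
  ultimately show ?thesis by (rule that)
qed

section \<open>Labellings in an FI-graph\<close>

context FI_graph
begin

lemma T_vert: "f \<in> FI_hom m n \<Longrightarrow> v \<in> verts (G m) \<Longrightarrow> T m n f v \<in> verts (G n)"
  using hom by (auto simp: graph_hom_def)

lemma T_edge: "f \<in> FI_hom m n \<Longrightarrow> e \<in> edges (G m) \<Longrightarrow> T m n f ` e \<in> edges (G n)"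
proof -
  assume f: "f \<in> FI_hom m n" and e: "e \<in> edges (G m)"
  obtain u v where "e = {u, v}" using graph e by (rule simple_graph_edgeE)
  with hom[OF f] e show ?thesis by (simp add: graph_hom_def)
qed

text \<open>Stability descends one degree at a time, and functoriality composes the injections found
  on the way; the base case is the identity.\<close>

lemma generated_in_stable_degree:
  assumes "vertex_stable G T d" "d \<le> n" "v \<in> verts (G n)"
  obtains w f where "w \<in> verts (G d)" "f \<in> FI_hom d n" "T d n f w = v"
proof -
  have "\<exists>w\<in>verts (G d). \<exists>f\<in>FI_hom d n. T d n f w = v"
    using assms(2,3)
  proof (induction n arbitrary: v rule: dec_induct)
    case base
    then show ?case using map_id inclusion_in_FI_hom[of d d] by blast
  next
    case (step n)
    then have "\<exists>w\<in>verts (G n). \<exists>f\<in>FI_hom n (Suc n). T n (Suc n) f w = v"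
      using assms(1) unfolding vertex_stable_def Suc_eq_plus1 by blast
    then obtain w f where w: "w \<in> verts (G n)" "f \<in> FI_hom n (Suc n)" "T n (Suc n) f w = v"
      by blast
    from step.IH[OF w(1)] obtain w' f' where w': "w' \<in> verts (G d)" "f' \<in> FI_hom d n" "T d n f' w' = w"
      by blast
    have "T d (Suc n) (compose {1..d} f f') w' = v"
      using map_comp[OF w'(2) w(2) w'(1)] w w' by simp
    with w' FI_hom_compose[OF w'(2) w(2)] show ?case by blast
  qed
  with that show ?thesis by blast
qed

text \<open>This is G(f) \<circ> x for a labelling \<open>x\<close> with values in G_m.\<close>

definition label_map :: "nat \<Rightarrow> nat \<Rightarrow> (nat \<Rightarrow> nat) \<Rightarrow> ('b \<Rightarrow> 'a) \<Rightarrow> 'b \<Rightarrow> 'a" where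
  "label_map m n f x u = T m n f (x u)"

lemma label_map_compose:
  assumes "f \<in> FI_hom l m" "h \<in> FI_hom m n" "x u \<in> verts (G l)"
  shows "label_map l n (compose {1..l} h f) x u = T m n h (label_map l m f x u)"
  using map_comp assms by (simp add: label_map_def)

text \<open>By functoriality, the copy obtained in G_n depends only on the copy in G_m and on
  \<open>h\<close>, not on the pair (f, x) behind it. This is the compatibility that counting
  classes requires.\<close>

lemma image_graph_label_map_compose:
  assumes "simple_graph H" "f \<in> FI_hom l m" "h \<in> FI_hom m n" "x \<in> verts H \<rightarrow> verts (G l)"
  shows "image_graph (label_map l n (compose {1..l} h f) x) H =
    image_graph (T m n h) (image_graph (label_map l m f x) H)"
  unfolding image_graph_comp[symmetric]
  by (rule image_graph_cong[OF assms(1)], rule label_map_compose[OF assms(2,3)])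
    (rule funcset_mem[OF assms(4)])

text \<open>Vertices that collide in G_m still collide after applying G(h).\<close>

lemma inj_on_label_map_compose:
  assumes "f \<in> FI_hom l m" "h \<in> FI_hom m n" "x \<in> A \<rightarrow> verts (G l)"
    and "inj_on (label_map l n (compose {1..l} h f) x) A"
  shows "inj_on (label_map l m f x) A"
proof (rule inj_onI)
  fix u v assume "u \<in> A" "v \<in> A" "label_map l m f x u = label_map l m f x v"
  moreover from this assms(3) have "x u \<in> verts (G l)" "x v \<in> verts (G l)" by auto
  ultimately show "u = v"
    using inj_onD[OF assms(4), of u v]
      label_map_compose[OF assms(1,2), of x u] label_map_compose[OF assms(1,2), of x v] by simp
qed

text \<open>G(h) is a homomorphism, so it sends the edges found in G_m to edges of G_n.\<close>

lemma edges_label_map_compose: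
  assumes "simple_graph H" "f \<in> FI_hom l m" "h \<in> FI_hom m n" "x \<in> verts H \<rightarrow> verts (G l)"
    and "edges (image_graph (label_map l m f x) H) \<subseteq> edges (G m)"
  shows "edges (image_graph (label_map l n (compose {1..l} h f) x) H) \<subseteq> edges (G n)"
  unfolding image_graph_label_map_compose[OF assms(1-4)]
  using assms(5) T_edge[OF assms(3)] by (auto simp: image_graph_def)

text \<open>Injectivity of a labelling can only be lost, and its being a homomorphism can only be gained,
  as \<open>n\<close> grows.\<close>

lemma embeds_label_map_eventually_constant:
  assumes H: "simple_graph H" and x: "x \<in> verts H \<rightarrow> verts (G D)"
  shows "\<exists>b. \<forall>\<^sub>F n in sequentially. \<forall>f \<in> FI_hom D n. embeds (label_map D n f x) H (G n) \<longleftrightarrow> b"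
proof -
  \<comment> \<open>\<open>A\<close> (a collision) and \<open>B\<close> (edges go to edges) ask for
    some \<open>f\<close>, so they pass to n+1 along the inclusion. Permutations then show that some
    \<open>f\<close> and every \<open>f\<close> amount to the same.\<close>
  define A where "A n \<longleftrightarrow> (\<exists>f\<in>FI_hom D n. \<not> inj_on (label_map D n f x) (verts H))" for n
  define B where "B n \<longleftrightarrow> (\<exists>f\<in>FI_hom D n. edges (image_graph (label_map D n f x) H) \<subseteq> edges (G n))" for n
  have incl: "(\<lambda>i\<in>{1..n}. i) \<in> FI_hom n (Suc n)" for n by (rule inclusion_in_FI_hom) simp
  have "A (Suc n)" if "A n" for n
  proof -
    from that obtain f where f: "f \<in> FI_hom D n" "\<not> inj_on (label_map D n f x) (verts H)"
      by (auto simp: A_def)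
    with inj_on_label_map_compose[OF f(1) incl x] FI_hom_compose[OF f(1) incl]
    show ?thesis unfolding A_def by blast
  qed
  then obtain a where a: "\<forall>\<^sub>F n in sequentially. A n \<longleftrightarrow> a"
    using eventually_constant_if_mono[of 0 A] by blast
  have "B (Suc n)" if "B n" for n
  proof -
    from that obtain f where f: "f \<in> FI_hom D n"
      "edges (image_graph (label_map D n f x) H) \<subseteq> edges (G n)"
      by (auto simp: B_def)
    with edges_label_map_compose[OF H f(1) incl x] FI_hom_compose[OF f(1) incl]
    show ?thesis unfolding B_def by blast
  qed
  then obtain b where b: "\<forall>\<^sub>F n in sequentially. B n \<longleftrightarrow> b"
    using eventually_constant_if_mono[of 0 B] by blast
  have A_iff: "A n \<longleftrightarrow> \<not> inj_on (label_map D n f x) (verts H)" if f: "f \<in> FI_hom D n" for n f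
  proof
    assume "A n"
    then obtain f' where f': "f' \<in> FI_hom D n" "\<not> inj_on (label_map D n f' x) (verts H)"
      by (auto simp: A_def)
    obtain \<sigma> where "\<sigma> \<in> FI_hom n n" "compose {1..D} \<sigma> f' = f"
      by (rule FI_hom_transitive[OF f'(1) f])
    with inj_on_label_map_compose[OF f'(1) _ x, of \<sigma> n] f'(2)
    show "\<not> inj_on (label_map D n f x) (verts H)" by auto
  qed (use f in \<open>auto simp: A_def\<close>)
  have B_iff: "B n \<longleftrightarrow> edges (image_graph (label_map D n f x) H) \<subseteq> edges (G n)"
    if f: "f \<in> FI_hom D n" for n f
  proof
    assume "B n"
    then obtain f' where f': "f' \<in> FI_hom D n"
      "edges (image_graph (label_map D n f' x) H) \<subseteq> edges (G n)"
      by (auto simp: B_def)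
    obtain \<sigma> where "\<sigma> \<in> FI_hom n n" "compose {1..D} \<sigma> f' = f"
      by (rule FI_hom_transitive[OF f'(1) f])
    with edges_label_map_compose[OF H f'(1) _ x, of \<sigma> n] f'(2)
    show "edges (image_graph (label_map D n f x) H) \<subseteq> edges (G n)" by auto
  qed (use f in \<open>auto simp: B_def\<close>)
  from a b have "\<forall>\<^sub>F n in sequentially.
      \<forall>f\<in>FI_hom D n. embeds (label_map D n f x) H (G n) \<longleftrightarrow> \<not> a \<and> b"
  proof eventually_elim
    case (elim n)
    show ?case
    proof
      fix f assume f: "f \<in> FI_hom D n"
      have "label_map D n f x ` verts H \<subseteq> verts (G n)"
        using T_vert[OF f] x by (auto simp: label_map_def)
      with A_iff[OF f] B_iff[OF f] elim show "embeds (label_map D n f x) H (G n) \<longleftrightarrow> \<not> a \<and> b"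
        by (auto simp: embeds_def image_graph_def)
    qed
  qed
  then show ?thesis by (rule exI)
qed

text \<open>Each vertex in the image comes from G_d along some \<open>g u\<close>. Factoring all
  \<open>g u\<close> through one injection \<open>f\<close> moves their differences into the
  labelling, with x(u) = G(k u)(w u).\<close>

lemma label_map_onto:
  assumes st: "vertex_stable G T d" and A: "finite A" "card A * d \<le> n"
    and \<psi>: "\<psi> ` A \<subseteq> verts (G n)"
  obtains f x where "f \<in> FI_hom (card A * d) n" "x \<in> A \<rightarrow>\<^sub>E verts (G (card A * d))"
    "\<And>u. u \<in> A \<Longrightarrow> label_map (card A * d) n f x u = \<psi> u"
proof -
  define D where "D = card A * d"
  have "\<exists>w g. w \<in> verts (G d) \<and> g \<in> FI_hom d n \<and> T d n g w = \<psi> u" if "u \<in> A" for u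
  proof -
    \<comment> \<open>An element of \<open>A\<close> yields d \<le> card A * d \<le> n, so that
      stability applies at \<open>n\<close>.\<close>
    have "1 \<le> card A" using A(1) that by (auto simp: card_gt_0_iff Suc_le_eq One_nat_def)
    from mult_le_mono1[OF this, of d] A(2) have "d \<le> n" by linarith
    with st \<psi> that show ?thesis
      using generated_in_stable_degree[of d n "\<psi> u"] by blast
  qed
  then obtain w g where wg: "\<And>u. u \<in> A \<Longrightarrow> w u \<in> verts (G d)" "\<And>u. u \<in> A \<Longrightarrow> g u \<in> FI_hom d n"
    "\<And>u. u \<in> A \<Longrightarrow> T d n (g u) (w u) = \<psi> u" by metis
  obtain f k where f: "f \<in> FI_hom D n" and k: "\<And>u. u \<in> A \<Longrightarrow> k u \<in> FI_hom d D"
    "\<And>u. u \<in> A \<Longrightarrow> compose {1..d} f (k u) = g u"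
    by (rule FI_hom_common_factor[OF A, of g, folded D_def]) (blast intro: wg(2))+
  define x where "x = (\<lambda>u\<in>A. T d D (k u) (w u))"
  have x: "x \<in> A \<rightarrow>\<^sub>E verts (G D)" using T_vert k(1) wg(1) by (auto simp: x_def)
  have fx: "label_map D n f x u = \<psi> u" if "u \<in> A" for u
    using map_comp[OF k(1)[OF that] f wg(1)[OF that]] k(2)[OF that] wg(3)[OF that] that
    by (simp add: label_map_def x_def)
  show ?thesis
    by (rule that[folded D_def, OF f x fx])
qed

lemma card_copies_eventually_polynomial:
  assumes st: "vertex_stable G T d" and H: "simple_graph H"
  shows "\<exists>p :: rat poly. degree p \<le> card (verts H) * d \<and>
    (\<forall>\<^sub>F n in sequentially.
       of_nat (card {K \<in> subgraphs (G n). graph_iso K H}) = poly p (of_nat n))"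
proof -
  define D where "D = card (verts H) * d"
  define I where "I = verts H \<rightarrow>\<^sub>E verts (G D)"
  have finH: "finite (verts H)" using H by (simp add: simple_graph_def)
  have finI: "finite I"
    using finH graph[of D] by (auto simp: I_def simple_graph_def intro: finite_PiE)
  have I: "x \<in> verts H \<rightarrow> verts (G D)" if "x \<in> I" for x using that by (auto simp: I_def)
  define \<Phi> where "\<Phi> n f x = image_graph (label_map D n f x) H" for n f x
  have "\<forall>x\<in>I. \<exists>b. \<forall>\<^sub>F n in sequentially.
      \<forall>f\<in>FI_hom D n. embeds (label_map D n f x) H (G n) \<longleftrightarrow> b"
    by (intro ballI embeds_label_map_eventually_constant H I)
  from bchoice[OF this] obtain valid where valid: "\<forall>x\<in>I. \<forall>\<^sub>F n in sequentially.
      \<forall>f\<in>FI_hom D n. embeds (label_map D n f x) H (G n) \<longleftrightarrow> valid x"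
    by blast
  \<comment> \<open>Only labels that eventually embed are kept, so the label set does not vary with
    \<open>n\<close>.\<close>
  define J where "J = {x \<in> I. valid x}"
  define X where "X n = (\<lambda>(f, x). \<Phi> n f x) ` (FI_hom D n \<times> J)" for n
  have finJ: "finite J" using finI by (simp add: J_def)
  have "eventually_rational (\<lambda>n. of_nat (card (X n)))"
    unfolding X_def using finJ
  proof (rule eventually_rational_card_quotient)
    fix n m f g h x y
    assume "f \<in> FI_hom D n" "g \<in> FI_hom D n" "h \<in> FI_hom n m" "x \<in> J" "y \<in> J" "\<Phi> n f x = \<Phi> n g y"
    then show "\<Phi> m (compose {1..D} h f) x = \<Phi> m (compose {1..D} h g) y"
      using I unfolding \<Phi>_def J_def by (simp add: image_graph_label_map_compose[OF H])
  qed
  from eventually_polynomial_if_rational[OF this]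
  obtain p where p: "\<forall>\<^sub>F n in sequentially. rat_of_nat (card (X n)) = poly p (of_nat n)"
    unfolding eventually_polynomial_def by blast
  have "\<forall>\<^sub>F n in sequentially. \<bar>poly p (of_nat n)\<bar> \<le> of_nat (card J) * of_nat n ^ D"
    using p
  proof eventually_elim
    case (elim n)
    have "card (X n) \<le> card (FI_hom D n \<times> J)"
      unfolding X_def by (rule card_image_le) (simp add: finJ finite_FI_hom)
    also have "\<dots> \<le> card J * n ^ D" using card_FI_hom_le[of D n] by (simp add: card_cartesian_product)
    finally have "rat_of_nat (card (X n)) \<le> of_nat (card J * n ^ D)" by (rule of_nat_mono)
    then show ?case by (simp add: elim[symmetric])
  qed
  \<comment> \<open>There are at most \<open>card J * n ^ D\<close> pairs (f, x), hence at most that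
    many classes.\<close>
  then have "degree p \<le> D" by (rule degree_le_if_poly_bounded)
  have "\<forall>\<^sub>F n in sequentially. \<forall>x\<in>I. \<forall>f\<in>FI_hom D n. embeds (label_map D n f x) H (G n) \<longleftrightarrow> valid x"
    using finI valid by (rule eventually_ball_finite)
  then have "\<forall>\<^sub>F n in sequentially. {K \<in> subgraphs (G n). graph_iso K H} = X n"
    using eventually_ge_at_top[of D]
  proof eventually_elim
    case (elim n)
    show ?case
    proof (intro equalityI subsetI)
      fix K assume "K \<in> {K \<in> subgraphs (G n). graph_iso K H}"
      then obtain \<psi> where \<psi>: "embeds \<psi> H (G n)" "K = image_graph \<psi> H"
        using subgraph_is_image_graph[OF H, of K "G n"] by blast
      then have "\<psi> ` verts H \<subseteq> verts (G n)" by (simp add: embeds_def)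
      \<comment> \<open>The embedding is rewritten as a labelled injection; as it embeds at this
        \<open>n\<close>, already past the common threshold, its label lies in
        \<open>J\<close>.\<close>
      then obtain f x where fx: "f \<in> FI_hom D n" "x \<in> I"
        "\<And>u. u \<in> verts H \<Longrightarrow> label_map D n f x u = \<psi> u"
        using label_map_onto[OF st finH _ \<open>\<psi> ` verts H \<subseteq> verts (G n)\<close>] elim(2) unfolding D_def I_def by blast
      have "embeds (label_map D n f x) H (G n)" "K = \<Phi> n f x"
        using embeds_cong[OF H fx(3)] image_graph_cong[OF H fx(3)] \<psi> by (simp_all add: \<Phi>_def)
      with fx elim(1) show "K \<in> X n" by (auto simp: X_def J_def)
    next
      fix K assume "K \<in> X n"
      then obtain f x where "f \<in> FI_hom D n" "x \<in> J" "K = \<Phi> n f x" by (auto simp: X_def)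
      with elim(1) image_graph_in_subgraphs[OF H, of "label_map D n f x" "G n"]
      show "K \<in> {K \<in> subgraphs (G n). graph_iso K H}" by (simp add: J_def \<Phi>_def)
    qed
  qed
  with p have "\<forall>\<^sub>F n in sequentially.
      of_nat (card {K \<in> subgraphs (G n). graph_iso K H}) = poly p (of_nat n)"
    by eventually_elim simp
  with \<open>degree p \<le> D\<close> show ?thesis unfolding D_def by blast
qed

end

theorem theorem2:
  fixes G :: "nat \<Rightarrow> 'a ugraph"
    and T :: "nat \<Rightarrow> nat \<Rightarrow> (nat \<Rightarrow> nat) \<Rightarrow> 'a \<Rightarrow> 'a"
    and H :: "'b ugraph"
    and d :: nat
  assumes "FI_graph G T"
    and "vertex_stable G T d"
    and "simple_graph H"
  shows "\<exists>p :: rat poly. degree p \<le> card (verts H) * d \<and>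
           (\<forall>\<^sub>F n in sequentially.
              of_nat (card {K \<in> subgraphs (G n). graph_iso K H}) = poly p (of_nat n))"
  using FI_graph.card_copies_eventually_polynomial[OF assms] .

end
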